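(* Let $m\ge 1$ and $n\ge 2$ be integers, let $\mathbb{F}_m$ be the free group on $m$ generators with a finite symmetric generating set $S$ not containing the identity, and let $\mathcal{G}$ be the Schreier graph (with respect to $S$) induced by the free part of the shift action $\mathbb{F}_m\curvearrowright n^{\mathbb{F}_m}$. Then the Borel distinguishing number $D_B(\mathcal{G})$ is finite.
   Context: Here $n=\{0,\dots,n-1\}$ is a discrete alphabet and $n^{\mathbb{F}_m}$ carries the product Borel structure. The shift action of a group $\Gamma$ on $n^\Gamma$ is $(g\cdot x)(h)=x(hg)$. The free part is $X=\{x\in n^\Gamma : g\cdot x\neq x \text{ for all } g\in\Gamma\setminus\{e\}\}$, where $e$ is the identity. The Schreier graph $\mathcal{G}=(X,E)$ has vertex set $X$ and edges $x\,E\,y \iff x\neq y$ and $s\cdot x=y$ for some $s\in S$. For a Borel graph $\mathcal{G}=(X,E)$ ($X$ a standard Borel space, $E\subseteq X\times X$ Borel, symmetric, irreflexive), a Borel distinguishing $Y$-coloring is a Borel map $c:X\to Y$ into a standard Borel space $Y$ such that $c\circ\psi\neq c$ for every non-identity graph automorphism $\psi$ of $\mathcal{G}$ (not necessarily Borel). The Borel distinguishing number $D_B(\mathcal{G})$ is the minimum cardinality $|Y|$ of a standard Borel space $Y$ for which a Borel distinguishing $Y$-coloring exists. *)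

theory Defs
  imports "HOL-Analysis.Analysis" "HOL-Algebra.Generated_Groups"
begin

unbundle cardinal_syntax

section \<open>The free group on \<open>m\<close> generators\<close>

text \<open>
  The letter \<open>(i, True)\<close> stands for the \<open>i\<close>-th free generator and \<open>(i, False)\<close> for its inverse.
  Group elements are reduced words; multiplication is concatenation followed by free reduction.
\<close>

type_synonym letter = "nat \<times> bool"

definition inv_letter :: "letter \<Rightarrow> letter" where
  "inv_letter a = (fst a, \<not> snd a)"

definition reduced_word :: "letter list \<Rightarrow> bool" where
  "reduced_word w \<longleftrightarrow> successively (\<lambda>a b. b \<noteq> inv_letter a) w"

fun reduced_Cons :: "letter \<Rightarrow> letter list \<Rightarrow> letter list" where
  "reduced_Cons a [] = [a]"
| "reduced_Cons a (b # w) = (if b = inv_letter a then w else a # b # w)"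

definition free_reduce :: "letter list \<Rightarrow> letter list" where
  "free_reduce w = foldr reduced_Cons w []"

definition free_group :: "nat \<Rightarrow> letter list monoid" where
  "free_group m =
     \<lparr>carrier = {w. reduced_word w \<and> fst ` set w \<subseteq> {..<m}},
      mult = (\<lambda>u v. free_reduce (u @ v)),
      one = []\<rparr>"

lemma inv_letter_inv_letter [simp]: "inv_letter (inv_letter a) = a"
  by (simp add: inv_letter_def)

lemma fst_inv_letter [simp]: "fst (inv_letter a) = fst a"
  by (simp add: inv_letter_def)

lemma reduced_Nil [simp]: "reduced_word []"
  by (simp add: reduced_word_def)

lemma reduced_reduced_Cons: "reduced_word w \<Longrightarrow> reduced_word (reduced_Cons a w)"
  by (cases "(a, w)" rule: reduced_Cons.cases) (auto simp: reduced_word_def successively_Cons)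

lemma reduced_free_reduce: "reduced_word (free_reduce w)"
  by (induction w) (auto simp: free_reduce_def reduced_reduced_Cons)

lemma free_reduce_reduced: "reduced_word w \<Longrightarrow> free_reduce w = w"
proof (induction w)
  case (Cons a w)
  then show ?case
    by (cases w) (auto simp: free_reduce_def reduced_word_def)
qed (simp add: free_reduce_def)

lemma reduced_Cons_inv:
  assumes "reduced_word w"
  shows "reduced_Cons a (reduced_Cons (inv_letter a) w) = w"
proof (cases w)
  case (Cons b v)
  with assms show ?thesis
    by (cases v) (auto simp: reduced_word_def)
qed simp

lemma set_reduced_Cons: "fst ` set (reduced_Cons a w) \<subseteq> insert (fst a) (fst ` set w)"
  by (cases "(a, w)" rule: reduced_Cons.cases) auto

lemma set_free_reduce: "fst ` set (free_reduce w) \<subseteq> fst ` set w"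
proof (induction w)
  case (Cons a w)
  then show ?case
    using order_trans[OF set_reduced_Cons[of a "free_reduce w"] insert_mono[OF Cons.IH, of "fst a"]]
    by (simp add: free_reduce_def)
qed (simp add: free_reduce_def)

lemma reduced_foldr: "reduced_word w \<Longrightarrow> reduced_word (foldr reduced_Cons u w)"
  by (induction u) (auto simp: reduced_reduced_Cons)

lemma foldr_reduced_Cons:
  assumes "reduced_word w"
  shows "foldr reduced_Cons (reduced_Cons a u) w = reduced_Cons a (foldr reduced_Cons u w)"
proof (cases u)
  case (Cons b v)
  then show ?thesis
    using reduced_Cons_inv[OF reduced_foldr[OF assms, of v], of a] by auto
qed simp

lemma foldr_free_reduce:
  "reduced_word w \<Longrightarrow> foldr reduced_Cons (free_reduce u) w = foldr reduced_Cons u w"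
  by (induction u) (auto simp: free_reduce_def foldr_reduced_Cons)

lemma free_reduce_append: "free_reduce (u @ v) = foldr reduced_Cons u (free_reduce v)"
  by (simp add: free_reduce_def)

lemma free_reduce_left: "free_reduce (free_reduce u @ v) = free_reduce (u @ v)"
  by (simp add: free_reduce_append foldr_free_reduce reduced_free_reduce)

lemma free_reduce_right: "free_reduce (u @ free_reduce v) = free_reduce (u @ v)"
  by (simp add: free_reduce_append free_reduce_reduced reduced_free_reduce)

lemma free_reduce_inverse: "free_reduce (rev (map inv_letter w) @ w) = []"
proof (induction w)
  case (Cons a w)
  have "reduced_Cons (inv_letter a) (reduced_Cons a (free_reduce w)) = free_reduce w"
    using reduced_Cons_inv[OF reduced_free_reduce, of "inv_letter a" w] by simp
  with Cons show ?case
    by (simp add: free_reduce_def)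
qed (simp add: free_reduce_def)

lemma group_free_group: "group (free_group m)"
proof (rule groupI)
  fix x y assume "x \<in> carrier (free_group m)" "y \<in> carrier (free_group m)"
  then show "x \<otimes>\<^bsub>free_group m\<^esub> y \<in> carrier (free_group m)"
    using order_trans[OF set_free_reduce[of "x @ y"], of "{..<m}"]
    by (simp add: free_group_def reduced_free_reduce image_Un)
next
  fix x assume "x \<in> carrier (free_group m)"
  then show "\<exists>y\<in>carrier (free_group m). y \<otimes>\<^bsub>free_group m\<^esub> x = \<one>\<^bsub>free_group m\<^esub>"
    using order_trans[OF set_free_reduce[of "rev (map inv_letter x)"], of "{..<m}"]
    by (intro bexI[of _ "free_reduce (rev (map inv_letter x))"])
       (auto simp: free_group_def free_reduce_left free_reduce_inverse reduced_free_reduce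
           image_image)
qed (auto simp: free_group_def free_reduce_left free_reduce_reduced free_reduce_right)


section \<open>The free part of the shift action and its Schreier graph\<close>

definition shift :: "('g, 'b) monoid_scheme \<Rightarrow> 'g \<Rightarrow> ('g \<Rightarrow> nat) \<Rightarrow> 'g \<Rightarrow> nat" where
  "shift G g x = (\<lambda>h\<in>carrier G. x (h \<otimes>\<^bsub>G\<^esub> g))"

definition shift_space :: "('g, 'b) monoid_scheme \<Rightarrow> nat \<Rightarrow> ('g \<Rightarrow> nat) measure" where
  "shift_space G n = (\<Pi>\<^sub>M h\<in>carrier G. count_space {..<n})"

text \<open>
  Measurable spaces are represented by the type \<open>measure\<close>; only \<open>space\<close> and \<open>sets\<close> are relevant,
  the measures carried by these objects play no role.
\<close>

definition free_part :: "('g, 'b) monoid_scheme \<Rightarrow> nat \<Rightarrow> ('g \<Rightarrow> nat) measure" where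
  "free_part G n =
     restrict_space (shift_space G n)
       {x \<in> space (shift_space G n). \<forall>g\<in>carrier G - {\<one>\<^bsub>G\<^esub>}. shift G g x \<noteq> x}"

definition schreier_edges :: "('g, 'b) monoid_scheme \<Rightarrow> nat \<Rightarrow> 'g set \<Rightarrow> (('g \<Rightarrow> nat) \<times> ('g \<Rightarrow> nat)) set"
  where
  "schreier_edges G n S =
     {(x, y). x \<in> space (free_part G n) \<and> y \<in> space (free_part G n) \<and>
              x \<noteq> y \<and> (\<exists>s\<in>S. shift G s x = y)}"


section \<open>Borel distinguishing number\<close>

definition standard_borel :: "'a measure \<Rightarrow> bool" where
  "standard_borel M \<longleftrightarrow>
     (\<exists>T. completely_metrizable_space T \<and> separable_space T \<and> topspace T = space M \<and>
          sets M = sigma_sets (topspace T) {U. openin T U})"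

definition graph_automorphism :: "'a set \<Rightarrow> ('a \<times> 'a) set \<Rightarrow> ('a \<Rightarrow> 'a) \<Rightarrow> bool" where
  "graph_automorphism V E \<psi> \<longleftrightarrow>
     bij_betw \<psi> V V \<and> (\<forall>x\<in>V. \<forall>y\<in>V. (x, y) \<in> E \<longleftrightarrow> (\<psi> x, \<psi> y) \<in> E)"

definition borel_distinguishing_coloring ::
  "'a measure \<Rightarrow> ('a \<times> 'a) set \<Rightarrow> 'y measure \<Rightarrow> ('a \<Rightarrow> 'y) \<Rightarrow> bool" where
  "borel_distinguishing_coloring X E Y c \<longleftrightarrow>
     standard_borel Y \<and> c \<in> X \<rightarrow>\<^sub>M Y \<and>
     (\<forall>\<psi>. graph_automorphism (space X) E \<psi> \<and> (\<exists>x\<in>space X. \<psi> x \<noteq> x) \<longrightarrow>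
          (\<exists>x\<in>space X. c (\<psi> x) \<noteq> c x))"

text \<open>
  Every standard Borel space is Borel isomorphic to one whose points are real numbers, so letting
  the colour spaces \<open>Y\<close> range over the type \<open>real measure\<close> covers all of them up to isomorphism.
\<close>

definition borel_distinguishing_cards :: "'a measure \<Rightarrow> ('a \<times> 'a) set \<Rightarrow> real rel set" where
  "borel_distinguishing_cards X E =
     {|space Y| | Y c. borel_distinguishing_coloring X E Y c}"

text \<open>
  The minimum is a cardinal, determined up to order isomorphism \<open>=o\<close>.
\<close>

definition borel_distinguishing_number :: "'a measure \<Rightarrow> ('a \<times> 'a) set \<Rightarrow> real rel" where
  "borel_distinguishing_number X E =
     (SOME r. r \<in> borel_distinguishing_cards X E \<and>
              (\<forall>r'\<in>borel_distinguishing_cards X E. r \<le>o r'))"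

lemma borel_distinguishing_number_minimum:
  assumes "borel_distinguishing_cards X E \<noteq> {}"
  shows "borel_distinguishing_number X E \<in> borel_distinguishing_cards X E"
    and "r' \<in> borel_distinguishing_cards X E \<Longrightarrow> borel_distinguishing_number X E \<le>o r'"
proof -
  have "\<forall>r\<in>borel_distinguishing_cards X E. Card_order r"
    by (auto simp: borel_distinguishing_cards_def card_of_Card_order)
  then have "\<exists>r. r \<in> borel_distinguishing_cards X E \<and>
      (\<forall>r'\<in>borel_distinguishing_cards X E. r \<le>o r')"
    using exists_minim_Card_order[OF assms] by blast
  from someI_ex[OF this]
  show "borel_distinguishing_number X E \<in> borel_distinguishing_cards X E"
    and "r' \<in> borel_distinguishing_cards X E \<Longrightarrow> borel_distinguishing_number X E \<le>o r'"
    unfolding borel_distinguishing_number_def by blast+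
qed

end

theory Submission
  imports Defs
begin

text \<open>
  A colouring that is injective on each set of neighbours \<open>S \<cdot> x\<close> lets every vertex record which
  of its neighbours is \<open>s \<cdot> x\<close>, for each \<open>s \<in> S\<close>. An automorphism preserving this information is
  equivariant, and if it also preserves \<open>x(e)\<close> it fixes every \<open>x\<close>, since \<open>x(g) = (g \<cdot> x)(e)\<close>.
  A neighbour-injective colouring with finitely many colours is obtained greedily from one with
  countably many colours; the latter records, for each \<open>g = t s\<inverse>\<close> with \<open>s \<noteq> t\<close> in \<open>S\<close>, the first
  \<open>h\<close> with \<open>x(hg) \<noteq> x(h)\<close> together with \<open>x(h)\<close>.
\<close>

section \<open>Measurable colourings with countably and finitely many colours\<close>

text \<open>Points are treated in the order of \<open>\<phi>\<close>: each takes the least colour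
  avoiding those of the \<open>T g x\<close> with smaller \<open>\<phi>\<close>-value. There are at
  most \<open>card D\<close> of these, so some colour up to \<open>card D\<close> is free.\<close>

lemma finite_measurable_coloring:
  fixes T :: "'i \<Rightarrow> 'a \<Rightarrow> 'a" and \<phi> :: "'a \<Rightarrow> nat"
  assumes fin: "finite D"
    and T: "\<And>g. g \<in> D \<Longrightarrow> T g \<in> M \<rightarrow>\<^sub>M M"
    and \<phi>: "\<phi> \<in> M \<rightarrow>\<^sub>M count_space UNIV"
    and proper: "\<And>g x. g \<in> D \<Longrightarrow> x \<in> space M \<Longrightarrow> \<phi> (T g x) \<noteq> \<phi> x"
    and sym: "\<And>g. g \<in> D \<Longrightarrow> \<exists>h\<in>D. \<forall>x\<in>space M. T h (T g x) = x"
  obtains p :: "'a \<Rightarrow> nat" where "p \<in> M \<rightarrow>\<^sub>M count_space UNIV"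
    and "\<And>x. p x \<le> card D"
    and "\<And>g x. g \<in> D \<Longrightarrow> x \<in> space M \<Longrightarrow> p (T g x) \<noteq> p x"
proof -
  \<comment> \<open>Stage \<open>k\<close> has coloured the points with \<open>\<phi> x < k\<close>;
    the others still carry the default 0, which the guard \<open>\<phi> (T g x) < k\<close> keeps
    from being read. Working in stages gives measurability by induction on \<open>k\<close>.\<close>
  define q where "q = rec_nat (\<lambda>_. 0 :: nat) (\<lambda>k r x.
    if \<phi> x = k then LEAST c. \<forall>g\<in>D. \<phi> (T g x) < k \<longrightarrow> r (T g x) \<noteq> c else r x)"
  have q_Suc: "q (Suc k) x =
      (if \<phi> x = k then LEAST c. \<forall>g\<in>D. \<phi> (T g x) < k \<longrightarrow> q k (T g x) \<noteq> c else q k x)" for k x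
    by (simp add: q_def)
  define p where "p x = q (Suc (\<phi> x)) x" for x
  have q_eq_p: "q k x = p x" if "\<phi> x < k" for k x
    using that by (induction k) (auto simp: q_Suc p_def less_Suc_eq)
  have p_eq: "p x = (LEAST c. \<forall>g\<in>D. \<phi> (T g x) < \<phi> x \<longrightarrow> p (T g x) \<noteq> c)" for x
    by (simp add: p_def[of x] q_Suc q_eq_p cong: imp_cong)
  have free_color: "\<exists>c\<le>card D. \<forall>g\<in>D. \<phi> (T g x) < \<phi> x \<longrightarrow> p (T g x) \<noteq> c" for x
  proof -
    have "card ((\<lambda>g. p (T g x)) ` D) < card {..card D}"
      using card_image_le[OF fin, of "\<lambda>g. p (T g x)"] by simp
    then have "\<not> {..card D} \<subseteq> (\<lambda>g. p (T g x)) ` D"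
      using fin by (meson card_mono finite_imageI not_le)
    then show ?thesis by blast
  qed
  have less: "p (T g x) \<noteq> p x" if "g \<in> D" "\<phi> (T g x) < \<phi> x" for g x
  proof -
    have "\<forall>g\<in>D. \<phi> (T g x) < \<phi> x \<longrightarrow> p (T g x) \<noteq> p x"
      unfolding p_eq[of x] by (rule LeastI_ex) (use free_color in blast)
    with that show ?thesis by blast
  qed
  show thesis
  proof
    have q_meas: "q k \<in> M \<rightarrow>\<^sub>M count_space UNIV" for k
    proof (induction k)
      case (Suc k)
      note [measurable] = Suc.IH \<phi>
      have [measurable]: "(\<lambda>x. \<phi> (T g x)) \<in> M \<rightarrow>\<^sub>M count_space UNIV"
        "(\<lambda>x. q k (T g x)) \<in> M \<rightarrow>\<^sub>M count_space UNIV" if "g \<in> D" for g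
        using measurable_compose[OF T[OF that]] \<phi> Suc.IH by blast+
      have [measurable]: "Measurable.pred M
          (\<lambda>x. \<forall>g\<in>D. \<phi> (T g x) < k \<longrightarrow> q k (T g x) \<noteq> c)" for c
        by (rule pred_intros_finite(3)[OF fin]) measurable
      show ?case unfolding q_Suc[abs_def] by measurable
    qed (simp add: q_def)
    \<comment> \<open>On each of the countably many level sets of \<open>\<phi>\<close>,
      \<open>p\<close> agrees with a single stage \<open>q (Suc k)\<close>.\<close>
    show "p \<in> M \<rightarrow>\<^sub>M count_space UNIV"
      unfolding p_def
      by (rule measurable_compose_countable[OF q_meas \<phi>, of Suc])
  next
    fix x
    show "p x \<le> card D"
      unfolding p_eq[of x] using free_color[of x] by (elim exE conjE) (rule order_trans[OF Least_le])
  next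
    fix g x assume g: "g \<in> D" and x: "x \<in> space M"
    then obtain h where h: "h \<in> D" "T h (T g x) = x" using sym by blast
    \<comment> \<open>By \<open>proper\<close>, one of \<open>x\<close> and \<open>T g x\<close> has
      the smaller \<open>\<phi>\<close>-value. If it is \<open>x\<close>, then
      \<open>x = T h (T g x)\<close> is an earlier neighbour of \<open>T g x\<close>.\<close>
    show "p (T g x) \<noteq> p x"
      using less[OF g, of x] less[OF h(1), of "T g x"] proper[OF g x] h(2) by fastforce
  qed
qed

text \<open>Lists of naturals form a countable type, so \<open>to_nat\<close> packs finitely many
  colourings into one without losing information. This serves to treat all \<open>g \<in> D\<close>
  at once and to assemble the final colour.\<close>

lemma measurable_to_nat_map:
  fixes f :: "'i \<Rightarrow> 'a \<Rightarrow> nat"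
  assumes "\<And>i. i \<in> set is \<Longrightarrow> f i \<in> M \<rightarrow>\<^sub>M count_space UNIV"
  shows "(\<lambda>x. to_nat (map (\<lambda>i. f i x) is)) \<in> M \<rightarrow>\<^sub>M count_space UNIV"
proof -
  have "(\<lambda>x. map (\<lambda>i. f i x) is) \<in> M \<rightarrow>\<^sub>M count_space UNIV"
    using assms
  proof (induction "is")
    case (Cons i "is")
    have "(\<lambda>x. f i x # map (\<lambda>i. f i x) is) \<in> M \<rightarrow>\<^sub>M count_space UNIV"
      by (rule measurable_compose_countable[where f = "\<lambda>a x. a # map (\<lambda>i. f i x) is"])
         (use Cons in \<open>auto intro: measurable_compose\<close>)
    then show ?case by simp
  qed simp
  then show ?thesis by (rule measurable_compose) simp
qed

section \<open>Finite colour spaces and the minimal cardinal\<close>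

lemma standard_borel_count_space:
  assumes "finite A"
  shows "standard_borel (count_space A)"
  unfolding standard_borel_def
proof (intro exI conjI)
  show "completely_metrizable_space (discrete_topology A)"
    by (rule completely_metrizable_space_discrete_topology)
  show "separable_space (discrete_topology A)"
    using assms by (simp add: separable_space_discrete_topology countable_finite)
  show "sets (count_space A) =
      sigma_sets (topspace (discrete_topology A)) {U. openin (discrete_topology A) U}"
    using sigma_algebra.sigma_sets_eq[OF sigma_algebra_Pow[of A]]
    by (simp add: Pow_def)
qed simp

text \<open>One witness makes the set of attained cardinals nonempty, so that \<open>SOME\<close>
  picks a true minimum; this lies below \<open>|space Y|\<close>.\<close>

lemma cfinite_borel_distinguishing_number:
  fixes Y :: "real measure"
  assumes "borel_distinguishing_coloring X E Y c" and "finite (space Y)"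
  shows "BNF_Cardinal_Arithmetic.cfinite (borel_distinguishing_number X E)"
proof -
  have Y: "|space Y| \<in> borel_distinguishing_cards X E"
    using assms(1) by (auto simp: borel_distinguishing_cards_def)
  then have "borel_distinguishing_number X E \<in> borel_distinguishing_cards X E"
    and le: "borel_distinguishing_number X E \<le>o |space Y|"
    using borel_distinguishing_number_minimum by blast+
  then obtain Z :: "real measure" where Z: "borel_distinguishing_number X E = |space Z|"
    by (auto simp: borel_distinguishing_cards_def)
  with le assms(2) have "finite (space Z)"
    using card_of_ordLeq_finite by metis
  with Z show ?thesis
    by (simp add: BNF_Cardinal_Arithmetic.cfinite_def card_of_Card_order Field_card_of)
qed

section \<open>The shift action on the free part\<close>

context group
begin

lemma space_free_part:
  "space (free_part G n) =
     {x \<in> carrier G \<rightarrow>\<^sub>E {..<n}. \<forall>g\<in>carrier G - {\<one>}. shift G g x \<noteq> x}"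
  by (auto simp: free_part_def shift_space_def space_restrict_space space_PiM)

lemma shift_apply: "h \<in> carrier G \<Longrightarrow> shift G g x h = x (h \<otimes> g)"
  by (simp add: shift_def)

lemma shift_shift:
  "g \<in> carrier G \<Longrightarrow> k \<in> carrier G \<Longrightarrow> shift G g (shift G k x) = shift G (g \<otimes> k) x"
  by (auto simp: shift_def m_assoc restrict_def)

lemma shift_one: "x \<in> carrier G \<rightarrow>\<^sub>E A \<Longrightarrow> shift G \<one> x = x"
  by (auto simp: shift_def restrict_def PiE_def extensional_def)

text \<open>Stabilizers along an orbit are conjugate: if \<open>k\<close> fixes
  \<open>g \<cdot> x\<close>, then \<open>inv g \<otimes> (k \<otimes> g)\<close> fixes
  \<open>x\<close>.\<close>

lemma shift_free_part:
  assumes g: "g \<in> carrier G" and x: "x \<in> space (free_part G n)"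
  shows "shift G g x \<in> space (free_part G n)"
proof -
  have xE: "x \<in> carrier G \<rightarrow>\<^sub>E {..<n}" using x by (simp add: space_free_part)
  have "shift G k (shift G g x) \<noteq> shift G g x" if k: "k \<in> carrier G" "k \<noteq> \<one>" for k
  proof
    assume "shift G k (shift G g x) = shift G g x"
    then have "shift G (inv g) (shift G k (shift G g x)) = shift G (inv g) (shift G g x)"
      by simp
    then have "shift G (inv g \<otimes> (k \<otimes> g)) x = x"
      using g k xE by (simp add: shift_shift shift_one)
    moreover have "inv g \<otimes> (k \<otimes> g) \<noteq> \<one>"
      using g k by (metis inv_closed inv_equality inv_inv l_cancel_one' m_closed r_inv inv_solve_right' l_one)
    ultimately show False using g k x by (auto simp: space_free_part)
  qed
  moreover have "shift G g x \<in> carrier G \<rightarrow>\<^sub>E {..<n}"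
    using xE g by (auto simp: shift_def)
  ultimately show ?thesis by (auto simp: space_free_part)
qed

lemma measurable_eval_free_part:
  assumes "h \<in> carrier G"
  shows "(\<lambda>x. x h) \<in> free_part G n \<rightarrow>\<^sub>M count_space UNIV"
proof -
  have "(\<lambda>x. x h) \<in> shift_space G n \<rightarrow>\<^sub>M count_space {..<n}"
    unfolding shift_space_def using assms by (rule measurable_component_singleton)
  moreover have "(\<lambda>a. a) \<in> count_space {..<n} \<rightarrow>\<^sub>M count_space UNIV"
    by simp
  ultimately have "(\<lambda>x. x h) \<in> shift_space G n \<rightarrow>\<^sub>M count_space UNIV"
    by (rule measurable_compose)
  then show ?thesis
    unfolding free_part_def by (rule measurable_restrict_space1)
qed

lemma measurable_shift_free_part:
  assumes g: "g \<in> carrier G"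
  shows "shift G g \<in> free_part G n \<rightarrow>\<^sub>M free_part G n"
proof -
  have "shift G g \<in> shift_space G n \<rightarrow>\<^sub>M shift_space G n"
    unfolding shift_space_def shift_def
    by (rule measurable_restrict) (use g in \<open>auto intro: measurable_component_singleton\<close>)
  then have "shift G g \<in> free_part G n \<rightarrow>\<^sub>M shift_space G n"
    unfolding free_part_def by (rule measurable_restrict_space1)
  then show ?thesis
    using shift_free_part[OF g, of _ n]
    by (subst (2) free_part_def, intro measurable_restrict_space2)
       (auto simp: free_part_def space_restrict_space)
qed

section \<open>Colourings separating translates of a point\<close>

text \<open>Let \<open>h\<close> be the first element, in a fixed enumeration, at which
  \<open>x\<close> and \<open>g \<cdot> x\<close> differ. If \<open>g \<cdot> x\<close> had the
  colour of \<open>x\<close>, its recorded place would be \<open>h\<close> too, with equal recorded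
  values; but these are \<open>x (h \<otimes> g)\<close> and \<open>x h\<close>.\<close>

lemma countable_measurable_coloring:
  assumes ctbl: "countable (carrier G)" and g: "g \<in> carrier G" "g \<noteq> \<one>"
  obtains \<phi> :: "('a \<Rightarrow> nat) \<Rightarrow> nat" where "\<phi> \<in> free_part G n \<rightarrow>\<^sub>M count_space UNIV"
    and "\<And>x. x \<in> space (free_part G n) \<Longrightarrow> \<phi> (shift G g x) \<noteq> \<phi> x"
proof -
  \<comment> \<open>This enumeration is total and reaches every element, even when the carrier is
    finite.\<close>
  define e where "e = from_nat_into (carrier G)"
  have e: "e k \<in> carrier G" for k
    unfolding e_def by (rule from_nat_into) auto
  define d where "d x = (LEAST k. x (e k \<otimes> g) \<noteq> x (e k))" for x :: "'a \<Rightarrow> nat"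
  define \<phi> where "\<phi> x = prod_encode (d x, x (e (d x)))" for x
  have d: "x (e (d x) \<otimes> g) \<noteq> x (e (d x))" if x: "x \<in> space (free_part G n)" for x
  proof -
    have xE: "x \<in> carrier G \<rightarrow>\<^sub>E {..<n}" and "shift G g x \<noteq> x"
      using x g by (auto simp: space_free_part)
    moreover have "shift G g x = x" if "\<And>h. h \<in> carrier G \<Longrightarrow> x (h \<otimes> g) = x h"
      using xE that by (auto simp: shift_def restrict_def PiE_def extensional_def)
    ultimately obtain h where "h \<in> carrier G" "x (h \<otimes> g) \<noteq> x h"
      by blast
    then have "x (e (to_nat_on (carrier G) h) \<otimes> g) \<noteq> x (e (to_nat_on (carrier G) h))"
      using ctbl by (simp add: e_def)
    then show ?thesis unfolding d_def by (rule LeastI)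
  qed
  show thesis
  proof
    have [measurable]: "(\<lambda>x. x (e k)) \<in> free_part G n \<rightarrow>\<^sub>M count_space UNIV"
      "(\<lambda>x. x (e k \<otimes> g)) \<in> free_part G n \<rightarrow>\<^sub>M count_space UNIV" for k
      using e g by (simp_all add: measurable_eval_free_part)
    have d_meas: "d \<in> free_part G n \<rightarrow>\<^sub>M count_space UNIV"
      unfolding d_def by measurable
    show "\<phi> \<in> free_part G n \<rightarrow>\<^sub>M count_space UNIV"
      unfolding \<phi>_def
      by (rule measurable_compose_countable[where f = "\<lambda>k x. prod_encode (k, x (e k))", OF _ d_meas])
         (rule measurable_compose[where g = "\<lambda>a. prod_encode (_, a)"]; measurable)
  next
    fix x assume "x \<in> space (free_part G n)"
    then show "\<phi> (shift G g x) \<noteq> \<phi> x"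
      using d[of x] e[of "d x"] by (auto simp: \<phi>_def shift_apply)
  qed
qed

text \<open>Since \<open>t \<otimes> inv s\<close> carries \<open>s \<cdot> x\<close> to
  \<open>t \<cdot> x\<close>, injectivity on the neighbours follows from properness along the finite
  set \<open>D\<close> of these quotients.\<close>

lemma neighbour_injective_coloring:
  assumes ctbl: "countable (carrier G)" and S: "finite S" "S \<subseteq> carrier G"
  obtains p :: "('a \<Rightarrow> nat) \<Rightarrow> nat" and K where "p \<in> free_part G n \<rightarrow>\<^sub>M count_space UNIV"
    and "\<And>x. p x \<le> K"
    and "\<And>x. x \<in> space (free_part G n) \<Longrightarrow> inj_on (\<lambda>s. p (shift G s x)) S"
proof -
  define D where "D = {t \<otimes> inv s | s t. s \<in> S \<and> t \<in> S \<and> s \<noteq> t}"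
  have "D \<subseteq> (\<lambda>(s, t). t \<otimes> inv s) ` (S \<times> S)" by (auto simp: D_def)
  then have fin: "finite D" using S finite_subset by blast
  have D: "g \<in> carrier G" "g \<noteq> \<one>" if "g \<in> D" for g
    using that S by (auto simp: D_def) (metis inv_equality inv_inv inv_closed subsetD)
  \<comment> \<open>Closure under inverses supplies the symmetry that the greedy colouring
    requires.\<close>
  have D_inv: "inv g \<in> D" if "g \<in> D" for g
  proof -
    obtain s t where st: "g = t \<otimes> inv s" "s \<in> S" "t \<in> S" "s \<noteq> t"
      using \<open>g \<in> D\<close> by (auto simp: D_def)
    then have "inv g = s \<otimes> inv t" using S by (simp add: inv_mult_group subset_iff)
    with st show ?thesis unfolding D_def by blast
  qed
  have "\<exists>\<phi> :: ('a \<Rightarrow> nat) \<Rightarrow> nat. \<phi> \<in> free_part G n \<rightarrow>\<^sub>M count_space UNIV \<and>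
      (\<forall>x\<in>space (free_part G n). \<phi> (shift G g x) \<noteq> \<phi> x)" if "g \<in> D" for g
    using countable_measurable_coloring[OF ctbl D[OF that]] by metis
  then obtain \<phi> :: "'a \<Rightarrow> ('a \<Rightarrow> nat) \<Rightarrow> nat"
    where \<phi>: "\<And>g. g \<in> D \<Longrightarrow> \<phi> g \<in> free_part G n \<rightarrow>\<^sub>M count_space UNIV"
      and \<phi>_ne: "\<And>g x. g \<in> D \<Longrightarrow> x \<in> space (free_part G n) \<Longrightarrow> \<phi> g (shift G g x) \<noteq> \<phi> g x"
    by metis
  obtain gs where gs: "set gs = D" using fin finite_list by blast
  obtain p :: "('a \<Rightarrow> nat) \<Rightarrow> nat" where p: "p \<in> free_part G n \<rightarrow>\<^sub>M count_space UNIV"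
    and p_le: "\<And>x. p x \<le> card D"
    and p_ne: "\<And>g x. g \<in> D \<Longrightarrow> x \<in> space (free_part G n) \<Longrightarrow> p (shift G g x) \<noteq> p x"
  proof (rule finite_measurable_coloring[OF fin, of "shift G" "free_part G n"])
    show "shift G g \<in> free_part G n \<rightarrow>\<^sub>M free_part G n" if "g \<in> D" for g
      using D[OF that] by (simp add: measurable_shift_free_part)
    show "(\<lambda>x. to_nat (map (\<lambda>g. \<phi> g x) gs)) \<in> free_part G n \<rightarrow>\<^sub>M count_space UNIV"
      by (rule measurable_to_nat_map) (simp add: gs \<phi>)
    \<comment> \<open>The two lists already differ in the entry belonging to \<open>g\<close>
      itself.\<close>
    show "to_nat (map (\<lambda>h. \<phi> h (shift G g x)) gs) \<noteq> to_nat (map (\<lambda>h. \<phi> h x) gs)"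
      if "g \<in> D" "x \<in> space (free_part G n)" for g x
      using \<phi>_ne[OF that] that(1) by (auto simp: gs)
    show "\<exists>h\<in>D. \<forall>x\<in>space (free_part G n). shift G h (shift G g x) = x" if "g \<in> D" for g
      using D[OF that] D_inv[OF that]
      by (intro bexI[of _ "inv g"]) (auto simp: shift_shift space_free_part intro: shift_one)
  qed blast
  show thesis
  proof (rule that[OF p p_le])
    fix x assume x: "x \<in> space (free_part G n)"
    show "inj_on (\<lambda>s. p (shift G s x)) S"
    proof (rule inj_onI, rule ccontr)
      fix s t assume st: "s \<in> S" "t \<in> S" "p (shift G s x) = p (shift G t x)" "s \<noteq> t"
      then have car: "s \<in> carrier G" "t \<in> carrier G" using S by auto
      have "t \<otimes> inv s \<in> D" using st by (auto simp: D_def)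
      \<comment> \<open>Properness is applied at the point \<open>s \<cdot> x\<close>, which
        \<open>t \<otimes> inv s\<close> moves to \<open>t \<cdot> x\<close>.\<close>
      from p_ne[OF this shift_free_part[OF car(1) x]] show False
        using st car by (simp add: shift_shift m_assoc)
    qed
  qed
qed

text \<open>The colour of a point packs its own label \<open>p\<close>, the labels of its neighbours
  in a fixed order, and its value at the identity. The labels make a colour-preserving automorphism
  equivariant; the value then pins down each point.\<close>

lemma free_part_distinguishing_coloring:
  assumes ctbl: "countable (carrier G)" and S: "finite S" "S \<subseteq> carrier G"
    and gen: "generate G S = carrier G"
    and S_inv: "\<And>s. s \<in> S \<Longrightarrow> inv s \<in> S" and S_one: "\<one> \<notin> S"
  obtains c :: "('a \<Rightarrow> nat) \<Rightarrow> real" and Y where "finite (space Y)"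
    and "borel_distinguishing_coloring (free_part G n) (schreier_edges G n S) Y c"
proof -
  let ?X = "space (free_part G n)"
  obtain p :: "('a \<Rightarrow> nat) \<Rightarrow> nat" and K where p: "p \<in> free_part G n \<rightarrow>\<^sub>M count_space UNIV"
    and p_le: "\<And>x. p x \<le> K"
    and p_inj: "\<And>x. x \<in> ?X \<Longrightarrow> inj_on (\<lambda>s. p (shift G s x)) S"
    using neighbour_injective_coloring[OF ctbl S] by metis
  obtain ss where ss: "set ss = S" using S finite_list by blast
  define fs where "fs = (\<lambda>x :: 'a \<Rightarrow> nat. x \<one>) # map (\<lambda>s x. p (shift G s x)) ss @ [p]"
  define w where "w x = map (\<lambda>f. f x) fs" for x
  \<comment> \<open>The embedding into \<open>real\<close> matches the type over which the colour
    spaces range.\<close>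
  define c where "c x = real (to_nat (w x))" for x
  have w_eq: "w x = w y \<longleftrightarrow> x \<one> = y \<one> \<and> (\<forall>s\<in>S. p (shift G s x) = p (shift G s y)) \<and> p x = p y"
    for x y by (auto simp: w_def fs_def simp flip: ss)
  have "w ` ?X \<subseteq> {l. set l \<subseteq> {..<n} \<union> {..K} \<and> length l = length fs}"
    using p_le by (auto simp: w_def fs_def space_free_part PiE_iff)
  then have "finite (w ` ?X)"
    by (rule finite_subset) (rule finite_lists_length_eq, simp)
  then have fin: "finite (c ` ?X)"
    unfolding c_def by (metis finite_imageI image_image)
  have "f \<in> free_part G n \<rightarrow>\<^sub>M count_space UNIV" if "f \<in> set fs" for f
    using that p S measurable_eval_free_part
    by (auto simp: fs_def ss intro: measurable_compose[OF measurable_shift_free_part])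
  then have "(\<lambda>x. to_nat (w x)) \<in> free_part G n \<rightarrow>\<^sub>M count_space UNIV"
    unfolding w_def by (rule measurable_to_nat_map)
  then have "c \<in> free_part G n \<rightarrow>\<^sub>M count_space UNIV"
    unfolding c_def by (rule measurable_compose) simp
  \<comment> \<open>Shrinking the codomain to the image makes the colour space finite and
    discrete.\<close>
  then have c_meas: "c \<in> free_part G n \<rightarrow>\<^sub>M count_space (c ` ?X)"
    using fin by (auto simp: measurable_count_space_eq2 intro: measurable_sets)
  have "\<psi> x = x" if \<psi>: "graph_automorphism ?X (schreier_edges G n S) \<psi>"
    and c_\<psi>: "\<And>x. x \<in> ?X \<Longrightarrow> c (\<psi> x) = c x" and x: "x \<in> ?X" for \<psi> x
  proof -
    have \<psi>_X: "\<psi> x \<in> ?X" if "x \<in> ?X" for x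
      using \<psi> that by (auto simp: graph_automorphism_def bij_betw_def)
    have w_\<psi>: "w (\<psi> x) = w x" if "x \<in> ?X" for x
      using c_\<psi>[OF that] by (simp add: c_def)
    have gen_eq: "\<psi> (shift G s x) = shift G s (\<psi> x)" if s: "s \<in> S" and x: "x \<in> ?X" for s x
    proof -
      have sX: "shift G s x \<in> ?X" using s S x by (auto intro: shift_free_part)
      have "shift G s x \<noteq> x" using s S x S_one by (auto simp: space_free_part)
      then have "(x, shift G s x) \<in> schreier_edges G n S"
        using s x sX by (auto simp: schreier_edges_def)
      then have "(\<psi> x, \<psi> (shift G s x)) \<in> schreier_edges G n S"
        using \<psi> x sX by (auto simp: graph_automorphism_def)
      then obtain t where t: "t \<in> S" "shift G t (\<psi> x) = \<psi> (shift G s x)"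
        by (auto simp: schreier_edges_def)
      \<comment> \<open>The edge yields only some \<open>t \<in> S\<close>. The colour of
        \<open>s \<cdot> x\<close> gives \<open>p (\<psi> (s \<cdot> x)) = p (s \<cdot> x)\<close>,
        and that of \<open>x\<close> gives
        \<open>p (s \<cdot> x) = p (s \<cdot> \<psi> x)\<close>.\<close>
      have "p (shift G t (\<psi> x)) = p (shift G s (\<psi> x))"
        using t s w_\<psi>[OF x] w_\<psi>[OF sX] by (simp add: w_eq)
      with p_inj[OF \<psi>_X[OF x]] s t(1) have "t = s" by (auto dest: inj_onD)
      with t show ?thesis by simp
    qed
    \<comment> \<open>The point varies in the induction, since for a product
      \<open>g \<otimes> h\<close> the hypothesis on \<open>g\<close> is used at
      \<open>h \<cdot> x\<close>.\<close>
    have equiv: "\<psi> (shift G g x) = shift G g (\<psi> x)" if "g \<in> generate G S" "x \<in> ?X" for g x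
      using that
    proof (induction arbitrary: x)
      case one
      then have "shift G \<one> x = x" "shift G \<one> (\<psi> x) = \<psi> x"
        using \<psi>_X[of x] by (auto simp: space_free_part intro: shift_one)
      then show ?case by simp
    next
      case (eng g h)
      then have gh: "g \<in> carrier G" "h \<in> carrier G" by (simp_all add: gen)
      then show ?case
        using eng.IH(1)[OF shift_free_part[OF gh(2) eng.prems]] eng.IH(2)[OF eng.prems]
        by (simp add: shift_shift)
    qed (simp_all add: gen_eq S_inv)
    show "\<psi> x = x"
    proof (rule PiE_ext)
      show "\<psi> x \<in> carrier G \<rightarrow>\<^sub>E {..<n}" "x \<in> carrier G \<rightarrow>\<^sub>E {..<n}"
        using x \<psi>_X[OF x] by (simp_all add: space_free_part)
      fix g assume g: "g \<in> carrier G"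
      \<comment> \<open>Every coordinate is the value at the identity of some translate, and the
        colour records that value.\<close>
      have "\<psi> x g = shift G g (\<psi> x) \<one>" using g by (simp add: shift_apply)
      also have "\<dots> = \<psi> (shift G g x) \<one>" using equiv g x gen by simp
      also have "\<dots> = shift G g x \<one>"
        using w_\<psi>[OF shift_free_part[OF g x]] by (simp add: w_eq)
      also have "\<dots> = x g" using g by (simp add: shift_apply)
      finally show "\<psi> x g = x g" .
    qed
  qed
  then have "borel_distinguishing_coloring (free_part G n) (schreier_edges G n S)
      (count_space (c ` ?X)) c"
    unfolding borel_distinguishing_coloring_def
    using standard_borel_count_space[OF fin] c_meas by blast
  then show thesis using fin by (intro that[of "count_space (c ` ?X)" c]) auto
qed

end

section \<open>The case of the free group\<close>

theorem corollary6p2: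
  fixes m n :: nat and S :: "letter list set"
  assumes "m \<ge> 1" and "n \<ge> 2"
    and "finite S" and "S \<subseteq> carrier (free_group m)"
    and "\<And>s. s \<in> S \<Longrightarrow> inv\<^bsub>free_group m\<^esub> s \<in> S"
    and "generate (free_group m) S = carrier (free_group m)"
    and "\<one>\<^bsub>free_group m\<^esub> \<notin> S"
  shows "BNF_Cardinal_Arithmetic.cfinite (borel_distinguishing_number
           (free_part (free_group m) n) (schreier_edges (free_group m) n S))"
proof -
  obtain c :: "(letter list \<Rightarrow> nat) \<Rightarrow> real" and Y where "finite (space Y)"
    and "borel_distinguishing_coloring (free_part (free_group m) n)
          (schreier_edges (free_group m) n S) Y c"
    \<comment> \<open>The group is countable because its elements are lists over a countable
      type.\<close>
    using group.free_part_distinguishing_coloring[OF group_free_group _ assms(3,4,6,5,7)]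
    by (metis countableI_type)
  then show ?thesis by (rule cfinite_borel_distinguishing_number[rotated])
qed

end
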